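(* Let $b\in \mathbb{R}\setminus \mathbb{Z}$. There exists a continuous function $\pi_{\infty}:\mathbb{R}\to\mathbb{R}_+$ that is a facet (and therefore extreme) for $I_b$ with an infinite number of slopes, i.e., the derivative of $\pi_\infty$ (where it exists) takes infinitely many distinct values.
   Context: Let $\mathbb{R}_+$ and $\mathbb{Z}_+$ denote the nonnegative reals and integers. For $b\in\mathbb{R}\setminus\mathbb{Z}$, the (one-dimensional) infinite group relaxation $I_b$ is the set of functions $y:\mathbb{R}\to\mathbb{Z}_+$ with finite support satisfying $\sum_{r\in\mathbb{R}} r\,y(r)\in b+\mathbb{Z}$. A function $\pi:\mathbb{R}\to\mathbb{R}_+$ is valid for $I_b$ if $\sum_{r\in\mathbb{R}}\pi(r)y(r)\ge 1$ for every $y\in I_b$. A valid function $\pi$ is extreme if $\pi=\pi_1=\pi_2$ for every pair of valid functions $\pi_1,\pi_2$ with $\pi=\frac{\pi_1+\pi_2}{2}$. For a valid function $\pi$ let $P(\pi):=\{y\in I_b: \sum_{r\in\mathbb{R}}\pi(r)y(r)=1\}$. A valid function $\pi$ is a facet if for every valid function $\pi'$, $P(\pi)\subseteq P(\pi')$ implies $\pi=\pi'$. *)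

theory Defs
  imports "HOL-Analysis.Analysis"
begin

definition supp :: "(real \<Rightarrow> nat) \<Rightarrow> real set" where
  "supp y = {r. y r \<noteq> 0}"

(* Summing over the support gives the sum over all real r: the other terms vanish. *)
definition group_relaxation :: "real \<Rightarrow> (real \<Rightarrow> nat) set" where
  "group_relaxation b =
     {y. finite (supp y) \<and> (\<exists>k::int. (\<Sum>r\<in>supp y. r * real (y r)) = b + of_int k)}"

definition group_value :: "(real \<Rightarrow> real) \<Rightarrow> (real \<Rightarrow> nat) \<Rightarrow> real" where
  "group_value \<pi> y = (\<Sum>r\<in>supp y. \<pi> r * real (y r))"

(* Functions into the nonnegative reals are real functions with an explicit sign condition,
   which is part of validity. *)
definition valid_function :: "real \<Rightarrow> (real \<Rightarrow> real) \<Rightarrow> bool" where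
  "valid_function b \<pi> \<longleftrightarrow>
     (\<forall>r. 0 \<le> \<pi> r) \<and> (\<forall>y\<in>group_relaxation b. 1 \<le> group_value \<pi> y)"

definition extreme_function :: "real \<Rightarrow> (real \<Rightarrow> real) \<Rightarrow> bool" where
  "extreme_function b \<pi> \<longleftrightarrow> valid_function b \<pi> \<and>
     (\<forall>\<pi>1 \<pi>2. valid_function b \<pi>1 \<longrightarrow> valid_function b \<pi>2 \<longrightarrow>
        (\<forall>r. \<pi> r = (\<pi>1 r + \<pi>2 r) / 2) \<longrightarrow> \<pi> = \<pi>1 \<and> \<pi> = \<pi>2)"

definition tight_points :: "real \<Rightarrow> (real \<Rightarrow> real) \<Rightarrow> (real \<Rightarrow> nat) set" where
  "tight_points b \<pi> = {y \<in> group_relaxation b. group_value \<pi> y = 1}"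

definition facet :: "real \<Rightarrow> (real \<Rightarrow> real) \<Rightarrow> bool" where
  "facet b \<pi> \<longleftrightarrow> valid_function b \<pi> \<and>
     (\<forall>\<pi>'. valid_function b \<pi>' \<longrightarrow> tight_points b \<pi> \<subseteq> tight_points b \<pi>' \<longrightarrow> \<pi> = \<pi>')"

definition slopes :: "(real \<Rightarrow> real) \<Rightarrow> real set" where
  "slopes \<pi> = {d. \<exists>x. (\<pi> has_real_derivative d) (at x)}"

end

(* Up to a translation and a reflection, 0 < b <= 1/2. Write the facet as (Phi x - x) / (1 - b),
   where Phi (x + 1) = Phi x + 1: this makes Phi nondecreasing, equal to 1 on [b,1], and on [0,b]
   a rescaled function G on [0,1] with G u + G (1 - u) = 1. On [0,1/2], G consists of flats
   alternating with ramps 2^j u that accumulate at 0; all that subadditivity of Phi needs is that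
   G is nondecreasing there, that G u / u is nonincreasing, and that G (1/2) = 1/2.

   For uniqueness, let F be additive wherever Phi is. Since Phi = 0 on [b - 1, 0], the interval
   lemma makes F vanish there, so F is constant on each flat of Phi; each ramp has the form
   [p, 4p], where the interval lemma makes F a multiple of x. Reflection fixes F (b/2) = 1/2, and
   from there the values propagate down the alternating flats and ramps to 0. *)

theory Submission
  imports Defs
begin

section \<open>A sufficient condition for facets\<close>

lemma supp_count_list: "supp (count_list xs) = set xs"
  by (auto simp: supp_def count_list_0_iff)

text \<open>Lists with repetition give explicit points such as \<open>[x, b - x]\<close> without a
  case distinction on whether the entries coincide.\<close>

lemma sum_count_list:
  fixes f :: "real \<Rightarrow> real"
  shows "(\<Sum>r\<in>set xs. f r * real (count_list xs r)) = sum_list (map f xs)"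
proof (induction xs)
  case (Cons a xs)
  have "(\<Sum>r\<in>set (a # xs). f r * real (count_list (a # xs) r))
      = (\<Sum>r\<in>insert a (set xs). f r * real (count_list xs r) + (if r = a then f r else 0))"
    by (intro sum.cong) (auto simp: algebra_simps)
  also have "\<dots> = (\<Sum>r\<in>insert a (set xs). f r * real (count_list xs r)) + f a"
    by (simp add: sum.distrib sum.delta)
  also have "(\<Sum>r\<in>insert a (set xs). f r * real (count_list xs r))
      = (\<Sum>r\<in>set xs. f r * real (count_list xs r))"
    by (rule sum.mono_neutral_right) (auto simp: count_list_0_iff)
  finally show ?case using Cons by simp
qed simp

lemma count_list_in_group_relaxation:
  "count_list xs \<in> group_relaxation b \<longleftrightarrow> (\<exists>k::int. sum_list xs = b + of_int k)"
  using sum_count_list[of "\<lambda>r. r" xs] by (simp add: group_relaxation_def supp_count_list)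

lemma group_value_count_list: "group_value \<pi> (count_list xs) = sum_list (map \<pi> xs)"
  by (simp add: group_value_def supp_count_list sum_count_list)

text \<open>Subadditivity bounds \<open>\<pi>\<close> of the weighted sum by the group value, and
  periodicity makes the former \<open>\<pi> b\<close>.\<close>

lemma valid_function_subadditive:
  fixes \<pi> :: "real \<Rightarrow> real"
  assumes nonneg: "\<And>x. 0 \<le> \<pi> x" and zero: "\<pi> 0 = 0" and pib: "\<pi> b = 1"
    and period: "\<And>x k. \<pi> (x + of_int k) = \<pi> x"
    and subadd: "\<And>x y. \<pi> (x + y) \<le> \<pi> x + \<pi> y"
  shows "valid_function b \<pi>"
proof -
  have mult: "\<pi> (r * real n) \<le> \<pi> r * real n" for r n
  proof (induction n)
    case (Suc n)
    then show ?case using subadd[of "r * real n" r] by (simp add: algebra_simps)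
  qed (simp add: zero)
  have sum: "\<pi> (sum f A) \<le> (\<Sum>r\<in>A. \<pi> (f r))" if "finite A" for f and A :: "real set"
    using that
  proof (induction A)
    case (insert x A)
    then show ?case using subadd[of "f x" "sum f A"] by simp
  qed (simp add: zero)
  have "1 \<le> group_value \<pi> y" if y: "y \<in> group_relaxation b" for y
  proof -
    obtain k :: int where fin: "finite (supp y)" and k: "(\<Sum>r\<in>supp y. r * real (y r)) = b + of_int k"
      using y unfolding group_relaxation_def by blast
    have "1 = \<pi> (\<Sum>r\<in>supp y. r * real (y r))"
      by (simp add: k period pib)
    also have "\<dots> \<le> (\<Sum>r\<in>supp y. \<pi> (r * real (y r)))"
      by (rule sum[OF fin])
    also have "\<dots> \<le> group_value \<pi> y"
      unfolding group_value_def by (intro sum_mono mult)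
    finally show ?thesis .
  qed
  then show ?thesis by (simp add: valid_function_def nonneg)
qed

text \<open>Points with two or three entries that are tight for \<open>\<pi>\<close> force a
  competitor \<open>\<psi>\<close> to be symmetric, periodic and additive wherever
  \<open>\<pi>\<close> is. What remains is the functional equation problem isolated in
  \<open>unique\<close>.\<close>

lemma facet_criterion:
  fixes \<pi> :: "real \<Rightarrow> real"
  assumes nonneg: "\<And>x. 0 \<le> \<pi> x" and zero: "\<pi> 0 = 0"
    and period: "\<And>x k. \<pi> (x + of_int k) = \<pi> x"
    and subadd: "\<And>x y. \<pi> (x + y) \<le> \<pi> x + \<pi> y"
    and symm: "\<And>x. \<pi> x + \<pi> (b - x) = 1"
    and unique: "\<And>\<psi>. \<lbrakk>\<And>x. 0 \<le> \<psi> x; \<psi> 0 = 0; \<And>x k. \<psi> (x + of_int k) = \<psi> x;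
        \<And>x. \<psi> x + \<psi> (b - x) = 1;
        \<And>x y. \<pi> (x + y) = \<pi> x + \<pi> y \<Longrightarrow> \<psi> (x + y) = \<psi> x + \<psi> y\<rbrakk> \<Longrightarrow> \<psi> = \<pi>"
  shows "facet b \<pi>"
proof -
  have pib: "\<pi> b = 1" using symm[of 0] zero by simp
  have valid: "valid_function b \<pi>"
    by (rule valid_function_subadditive) (fact nonneg zero pib period subadd)+
  have "\<pi> = \<psi>" if \<psi>: "valid_function b \<psi>" and sub: "tight_points b \<pi> \<subseteq> tight_points b \<psi>" for \<psi>
  proof -
    have tight: "sum_list (map \<psi> xs) = 1"
      if "sum_list xs = b + of_int k" "sum_list (map \<pi> xs) = 1" for xs k
    proof -
      have "count_list xs \<in> tight_points b \<pi>"
        using that by (auto simp: tight_points_def count_list_in_group_relaxation group_value_count_list)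
      with sub have "count_list xs \<in> tight_points b \<psi>" by blast
      then show ?thesis by (simp add: tight_points_def group_value_count_list)
    qed
    have \<psi>symm: "\<psi> x + \<psi> (b - x) = 1" for x
      using tight[of "[x, b - x]" 0] symm[of x] by simp
    have \<psi>period: "\<psi> (x + of_int k) = \<psi> x" for x k
      using tight[of "[x + of_int k, b - x]" k] symm[of x] period[of x k] \<psi>symm[of x] by simp
    \<comment> \<open>By symmetry the third entry \<open>b - (x + y)\<close> contributes
      \<open>1 - \<pi> (x + y)\<close>, so the triple is tight exactly when \<open>\<pi>\<close> is
      additive at \<open>(x, y)\<close>.\<close>
    have \<psi>add: "\<psi> (x + y) = \<psi> x + \<psi> y" if "\<pi> (x + y) = \<pi> x + \<pi> y" for x y
      using tight[of "[x, y, b - (x + y)]" 0] symm[of "x + y"] that \<psi>symm[of "x + y"] by simp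
    have "\<psi> 0 = 0" using \<psi>add[of 0 0] zero by simp
    then show ?thesis
      using unique[of \<psi>] \<psi> \<psi>symm \<psi>period \<psi>add by (simp add: valid_function_def)
  qed
  with valid show ?thesis by (simp add: facet_def)
qed

text \<open>Both halves of the average have value at least 1 on the relaxation, so a point tight for
  \<open>\<pi>\<close> is tight for each of them.\<close>

lemma facet_imp_extreme:
  assumes "facet b \<pi>"
  shows "extreme_function b \<pi>"
proof -
  have "\<pi> = \<pi>1"
    if v: "valid_function b \<pi>1" "valid_function b \<pi>2" and avg: "\<forall>r. \<pi> r = (\<pi>1 r + \<pi>2 r) / 2" for \<pi>1 \<pi>2
  proof -
    have avg_value: "group_value \<pi> y = (group_value \<pi>1 y + group_value \<pi>2 y) / 2" for y
      by (simp add: group_value_def avg sum.distrib[symmetric] sum_divide_distrib algebra_simps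
          add_divide_distrib)
    have "group_value \<pi>1 y = 1" if "y \<in> group_relaxation b" "group_value \<pi> y = 1" for y
    proof -
      have "1 \<le> group_value \<pi>1 y" "1 \<le> group_value \<pi>2 y"
        using v that by (simp_all add: valid_function_def)
      moreover have "group_value \<pi>1 y + group_value \<pi>2 y = 2"
        using avg_value[of y] that by simp
      ultimately show ?thesis by linarith
    qed
    then have "tight_points b \<pi> \<subseteq> tight_points b \<pi>1"
      by (auto simp: tight_points_def)
    with assms v show ?thesis by (auto simp: facet_def)
  qed
  note eq = this
  have "\<pi> = \<pi>1 \<and> \<pi> = \<pi>2"
    if v: "valid_function b \<pi>1" "valid_function b \<pi>2" and avg: "\<forall>r. \<pi> r = (\<pi>1 r + \<pi>2 r) / 2" for \<pi>1 \<pi>2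
    using eq[OF v avg] eq[OF v(2,1)] avg by (simp add: add.commute fun_eq_iff)
  with assms show ?thesis by (auto simp: extreme_function_def facet_def)
qed

section \<open>The interval lemma\<close>

text \<open>For each positive n, \<open>e\<close> vanishes at the multiples of L/n up to L.
  Subtracting such a multiple from t leaves a remainder r with n r \<le> L, and n |e r| = |e (n r)|
  \<le> C. Now let n grow.\<close>

lemma bounded_additive_zero:
  fixes e :: "real \<Rightarrow> real"
  assumes "0 < L" and add: "\<And>s t. \<lbrakk>0 \<le> s; 0 \<le> t; s + t \<le> L\<rbrakk> \<Longrightarrow> e (s + t) = e s + e t"
    and bound: "\<And>t. \<lbrakk>0 \<le> t; t \<le> L\<rbrakk> \<Longrightarrow> \<bar>e t\<bar> \<le> C"
    and "e L = 0" "0 \<le> t" "t \<le> L"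
  shows "e t = 0"
proof -
  have e0: "e 0 = 0" using add[of 0 0] \<open>0 < L\<close> by simp
  have mult: "e (real n * s) = real n * e s" if "0 \<le> s" "real n * s \<le> L" for n s
    using that
  proof (induction n)
    case (Suc n)
    then have "e (real n * s) = real n * e s" by (simp add: algebra_simps)
    then show ?case using add[of "real n * s" s] Suc.prems by (simp add: algebra_simps)
  qed (simp add: e0)
  have small: "\<bar>e t\<bar> \<le> C / real n" if "n > 0" for n :: nat
  proof -
    \<comment> \<open>The number of steps of length L/n that fit below t.\<close>
    define m where "m = nat \<lfloor>t * real n / L\<rfloor>"
    define r where "r = t - real m * (L / real n)"
    have m: "real m = of_int \<lfloor>t * real n / L\<rfloor>"
      using assms that by (simp add: m_def)
    have "real m \<le> t * real n / L" "t * real n / L < real m + 1"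
      unfolding m by linarith+
    then have "real m * L \<le> t * real n" "t * real n < (real m + 1) * L"
      using \<open>0 < L\<close> by (simp_all add: field_simps)
    moreover have "real n * r = t * real n - real m * L"
      using that by (simp add: r_def field_simps)
    ultimately have r: "0 \<le> real n * r" "real n * r \<le> L"
      by (simp_all add: algebra_simps)
    have r0: "0 \<le> r" using r(1) that by (simp add: zero_le_mult_iff)
    have mr: "real m * (L / real n) + r = t" by (simp add: r_def)
    have "real n * e (L / real n) = 0"
      using mult[of "L / real n" n] assms that by simp
    then have "e (L / real n) = 0" using that by simp
    moreover have "real m * (L / real n) \<le> L" using mr r0 \<open>t \<le> L\<close> by linarith
    ultimately have "e (real m * (L / real n)) = 0"
      using mult[of "L / real n" m] \<open>0 < L\<close> that by simp
    then have "e t = e r"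
      using add[of "real m * (L / real n)" r, unfolded mr] r0 assms by simp
    moreover have "real n * \<bar>e r\<bar> \<le> C"
      using mult[of r n] r r0 bound[of "real n * r"] by (simp add: abs_mult)
    ultimately show ?thesis using that by (simp add: field_simps)
  qed
  show ?thesis
  proof (rule ccontr)
    assume "e t \<noteq> 0"
    then obtain n :: nat where n: "C < real n * \<bar>e t\<bar>"
      using reals_Archimedean3[of "\<bar>e t\<bar>"] by auto
    have "0 \<le> C" using bound[of L] assms by simp
    with n have "n > 0" by (cases n) auto
    with small[of n] n show False by (simp add: field_simps)
  qed
qed

text \<open>The case of the Gomory-Johnson interval lemma in which both summands range over the same
  interval. The deviation \<open>e\<close> from the chord is additive in the offset from p, is
  bounded, and vanishes at the right end.\<close>

lemma interval_lemma:
  fixes f :: "real \<Rightarrow> real"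
  assumes "p < q" and add: "\<And>x y. \<lbrakk>x \<in> {p..q}; y \<in> {p..q}\<rbrakk> \<Longrightarrow> f (x + y) = f x + f y"
    and bound: "\<And>x. x \<in> {p..q} \<Longrightarrow> \<bar>f x\<bar> \<le> C"
  obtains \<tau> where "\<And>x. x \<in> {p..q} \<Longrightarrow> f x = f p + \<tau> * (x - p)"
proof
  define \<tau> where "\<tau> = (f q - f p) / (q - p)"
  define e where "e t = f (p + t) - f p - \<tau> * t" for t
  have e: "e t = 0" if "0 \<le> t" "t \<le> q - p" for t
  proof (rule bounded_additive_zero[where L = "q - p" and e = e])
    show "e (s + t) = e s + e t" if "0 \<le> s" "0 \<le> t" "s + t \<le> q - p" for s t
      \<comment> \<open>Both instances decompose f (2p + s + t), whence f (p + s) + f (p + t) = f p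
        + f (p + s + t).\<close>
      using add[of "p + s" "p + t"] add[of p "p + (s + t)"] that
      by (simp add: e_def algebra_simps)
    show "\<bar>e t\<bar> \<le> 2 * C + \<bar>\<tau>\<bar> * (q - p)" if "0 \<le> t" "t \<le> q - p" for t
    proof -
      have "\<bar>\<tau> * t\<bar> \<le> \<bar>\<tau>\<bar> * (q - p)"
        using that by (simp add: abs_mult mult_left_mono)
      then show ?thesis
        using bound[of "p + t"] bound[of p] that by (simp add: e_def)
    qed
    show "e (q - p) = 0" using \<open>p < q\<close> by (simp add: e_def \<tau>_def)
  qed (use that \<open>p < q\<close> in auto)
  show "f x = f p + \<tau> * (x - p)" if "x \<in> {p..q}" for x
    using e[of "x - p"] that by (simp add: e_def)
qed

text \<open>The relation f (2p) = 2 f p sends the affine function through the origin, and doubling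
  carries it from [p, 2p] to [p, 4p]. The slope is expressed by the value at 4p because in the
  application that end of the ramp is known first.\<close>

lemma interval_lemma_linear:
  fixes f :: "real \<Rightarrow> real"
  assumes "0 < p" and add: "\<And>x y. \<lbrakk>x \<in> {p..2*p}; y \<in> {p..2*p}\<rbrakk> \<Longrightarrow> f (x + y) = f x + f y"
    and bound: "\<And>x. x \<in> {p..2*p} \<Longrightarrow> \<bar>f x\<bar> \<le> C" and x: "x \<in> {p..4*p}"
  shows "f x = f (4*p) / (4*p) * x"
proof -
  obtain \<tau> where \<tau>: "\<And>x. x \<in> {p..2*p} \<Longrightarrow> f x = f p + \<tau> * (x - p)"
    using interval_lemma[of p "2*p" f C] assms by auto
  have "f (2*p) = 2 * f p" using add[of p p] \<open>0 < p\<close> by simp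
  with \<tau>[of "2*p"] have fp: "f p = \<tau> * p" using \<open>0 < p\<close> by simp
  have lin: "f x = \<tau> * x" if "x \<in> {p..2*p}" for x
    using \<tau>[OF that] fp by (simp add: algebra_simps)
  have lin4: "f x = \<tau> * x" if "x \<in> {p..4*p}" for x
  proof (cases "x \<le> 2*p")
    case False
    then have "x/2 \<in> {p..2*p}" using that by auto
    with add[of "x/2" "x/2"] lin[of "x/2"] show ?thesis by simp
  qed (use lin that in simp)
  show ?thesis using lin4[OF x] lin4[of "4*p"] \<open>0 < p\<close> by simp
qed

section \<open>Infinitely many flats and ramps\<close>

text \<open>The j-th term is a flat of height (1/4)^j / 2 followed by a ray of slope 2^j through the
  origin. Monotonicity and star-shapedness hold for each term and pass to the infimum, so no case
  distinction over the pieces is needed.\<close>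

definition stair :: "real \<Rightarrow> real" where
  "stair u = (INF j. max ((1/4)^j / 2) (2^j * u))"

lemma stair_le: "stair u \<le> max ((1/4)^j / 2) (2^j * u)"
  unfolding stair_def
  by (rule cINF_lower[OF bdd_belowI2[where m = 0]]) (auto simp: le_max_iff_disj)

lemma stair_ge: "(\<And>j. c \<le> max ((1/4)^j / 2) (2^j * u)) \<Longrightarrow> c \<le> stair u"
  unfolding stair_def by (rule cINF_greatest) auto

lemma stair_nonneg: "0 \<le> stair u"
  by (rule stair_ge) (simp add: le_max_iff_disj)

lemma stair_mono:
  assumes "u \<le> v"
  shows "stair u \<le> stair v"
proof (rule stair_ge)
  fix j :: nat
  have "2^j * u \<le> 2^j * v" using assms by simp
  then show "stair u \<le> max ((1/4)^j / 2) (2^j * v)"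
    using stair_le[of u j] by linarith
qed

text \<open>Divided by u, the j-th term is the maximum of a nonincreasing function and the constant
  2^j.\<close>

lemma stair_star_shaped:
  assumes "0 < u" "u \<le> v"
  shows "u * stair v \<le> v * stair u"
proof -
  have "u * stair v / v \<le> stair u"
  proof (rule stair_ge)
    fix j :: nat
    have "u * stair v \<le> u * max ((1/4)^j / 2) (2^j * v)"
      using assms stair_le by (simp add: mult_left_mono)
    also have "\<dots> = max (u * ((1/4)^j / 2)) (2^j * u * v)"
      using assms by (simp add: max_mult_distrib_left ac_simps)
    also have "\<dots> \<le> max (v * ((1/4)^j / 2)) (2^j * u * v)"
      using assms by (intro max.mono mult_right_mono) auto
    also have "\<dots> = v * max ((1/4)^j / 2) (2^j * u)"
      using assms by (simp add: max_mult_distrib_left mult.commute)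
    finally show "u * stair v / v \<le> max ((1/4)^j / 2) (2^j * u)"
      using assms by (simp add: field_simps)
  qed
  then show ?thesis using assms by (simp add: field_simps)
qed

text \<open>Star-shapedness gives \<open>stair u\<close> and \<open>stair v\<close> at least the
  shares u/(u + v) and v/(u + v) of \<open>stair (u + v)\<close>.\<close>

lemma stair_subadditive:
  assumes "0 \<le> u" "0 \<le> v"
  shows "stair (u + v) \<le> stair u + stair v"
proof (cases "u = 0 \<or> v = 0")
  case True
  then show ?thesis using stair_nonneg[of 0] by auto
next
  case False
  then have pos: "0 < u" "0 < v" using assms by auto
  have "u * stair (u + v) \<le> (u + v) * stair u" "v * stair (u + v) \<le> (u + v) * stair v"
    using stair_star_shaped[of u "u + v"] stair_star_shaped[of v "u + v"] pos by auto
  then have "(u + v) * stair (u + v) \<le> (u + v) * (stair u + stair v)"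
    by (simp add: algebra_simps)
  then show ?thesis using pos by simp
qed

text \<open>The ends of the interval are where rays j + 1 and j reach the height of flat j. Flats up
  to j are at least that high, and later rays are already above it.\<close>

lemma stair_flat:
  assumes "u \<in> {(1/8)^j / 4..(1/8)^j / 2}"
  shows "stair u = (1/4)^j / 2"
proof (rule antisym)
  have pow: "(2::real)^j * (1/8)^j = (1/4)^j" by (simp add: power_mult_distrib[symmetric])
  have "2^j * u \<le> 2^j * ((1/8)^j / 2)"
    using assms by (intro mult_left_mono) auto
  with pow show "stair u \<le> (1/4)^j / 2" using stair_le[of u j] by simp
  show "(1/4)^j / 2 \<le> stair u"
  proof (rule stair_ge)
    fix i :: nat
    show "(1/4)^j / 2 \<le> max ((1/4)^i / 2) (2^i * u)"
    proof (cases "i \<le> j")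
      case True
      then have "(1/4::real)^j \<le> (1/4)^i" by (simp add: power_decreasing)
      then show ?thesis by (intro max.coboundedI1) simp
    next
      case False
      then have "(2::real)^Suc j \<le> 2^i" by (intro power_increasing) auto
      moreover have "0 \<le> (1/8::real)^j / 4" by simp
      ultimately have "2^Suc j * ((1/8)^j / 4) \<le> 2^i * u"
        using assms by (intro mult_mono) auto
      with pow show ?thesis by simp
    qed
  qed
qed

text \<open>Later rays are steeper. Flats before j have height at least 2 * (1/4)^j, which ray j
  reaches only at the right end.\<close>

lemma stair_ramp:
  assumes "u \<in> {(1/8)^j / 2..2 * (1/8)^j}"
  shows "stair u = 2^j * u"
proof (rule antisym)
  have pow: "(2::real)^j * (1/8)^j = (1/4)^j" by (simp add: power_mult_distrib[symmetric])
  have "2^j * ((1/8)^j / 2) \<le> 2^j * u"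
    using assms by (intro mult_left_mono) auto
  with pow show "stair u \<le> 2^j * u" using stair_le[of u j] by simp
  have u: "0 \<le> u" using assms by (simp add: order_trans[of 0 "(1/8)^j / 2" u])
  show "2^j * u \<le> stair u"
  proof (rule stair_ge)
    fix i :: nat
    show "2^j * u \<le> max ((1/4)^i / 2) (2^i * u)"
    proof (cases "j \<le> i")
      case True
      then have "(2::real)^j * u \<le> 2^i * u" using u by (intro mult_right_mono power_increasing) auto
      then show ?thesis by simp
    next
      case False
      have "(2::real)^j * u \<le> 2^j * (2 * (1/8)^j)" using assms by (intro mult_left_mono) auto
      moreover have "(1/4::real)^j \<le> (1/4)^Suc i" using False by (intro power_decreasing) auto
      moreover have "(2::real)^j * (2 * (1/8)^j) = 2 * (1/4)^j" using pow by simp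
      ultimately have "2^j * u \<le> (1/4)^i / 2" by simp
      then show ?thesis by (rule max.coboundedI1)
    qed
  qed
qed

lemma stair_half: "stair (1/2) = 1/2"
  using stair_flat[of "1/2" 0] by simp

lemma stair_ge_self:
  assumes "0 \<le> u" "u \<le> 1/2"
  shows "u \<le> stair u"
proof (cases "u = 0")
  case False
  then show ?thesis using stair_star_shaped[of u "1/2"] stair_half assms by simp
qed (simp add: stair_nonneg)

lemma stair_small:
  assumes "0 < e"
  obtains d where "0 < d" "d \<le> 1/2" "stair d < e"
proof -
  obtain j where j: "(1/4::real)^j < e"
    using real_arch_pow_inv[of e "1/4"] assms by auto
  show thesis
  proof (rule that)
    show "(1/8)^j / 2 \<le> (1/2::real)" by (simp add: power_le_one)
    have "stair ((1/8)^j / 2) = (1/4)^j / 2" by (rule stair_flat) simp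
    also have "\<dots> \<le> (1/4)^j" by simp
    finally show "stair ((1/8)^j / 2) < e" using j by simp
  qed simp
qed

lemma stair_0: "stair 0 = 0"
proof (rule ccontr)
  assume "stair 0 \<noteq> 0"
  then have "0 < stair 0" using stair_nonneg[of 0] by simp
  then obtain d where "0 < d" "stair d < stair 0" by (rule stair_small)
  with stair_mono[of 0 d] show False by simp
qed

section \<open>The symmetrized staircase, called G in the overview\<close>

definition sym_stair :: "real \<Rightarrow> real" where
  "sym_stair u = (if u \<le> 1/2 then stair u else if u \<le> 1 then 1 - stair (1 - u) else 1)"

lemma sym_stair_le_1: "sym_stair u \<le> 1"
  using stair_mono[of u "1/2"] stair_half stair_nonneg[of "1 - u"]
  by (auto simp: sym_stair_def)

lemma sym_stair_nonneg: "0 \<le> sym_stair u"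
  using stair_mono[of "1 - u" "1/2"] stair_half stair_nonneg[of u]
  by (auto simp: sym_stair_def)

lemma sym_stair_mono: "u \<le> v \<Longrightarrow> sym_stair u \<le> sym_stair v"
  using stair_mono[of u v] stair_mono[of "1 - v" "1 - u"] stair_half
    stair_mono[of u "1/2"] stair_mono[of "1 - v" "1/2"] stair_mono[of "1 - u" "1/2"]
    stair_nonneg[of "1 - u"] stair_nonneg[of "1 - v"]
  by (auto simp: sym_stair_def)

lemma sym_stair_0: "sym_stair 0 = 0"
  by (simp add: sym_stair_def stair_0)

lemma sym_stair_1: "1 \<le> u \<Longrightarrow> sym_stair u = 1"
  by (auto simp: sym_stair_def stair_0)

lemma sym_stair_reflect: "\<lbrakk>0 \<le> u; u \<le> 1\<rbrakk> \<Longrightarrow> sym_stair (1 - u) = 1 - sym_stair u"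
  using stair_half by (cases "u = 1/2") (fastforce simp: sym_stair_def)+

text \<open>The factor 1/2 is what \<open>stair_lift_ge\<close> requires: with b \<le> 1/2, x is at
  most x / b / 2.\<close>

lemma sym_stair_ge_half:
  assumes "0 \<le> u" "u \<le> 1"
  shows "u / 2 \<le> sym_stair u"
proof (cases "u \<le> 1/2")
  case True
  then show ?thesis using stair_ge_self[of u] assms by (simp add: sym_stair_def)
next
  case False
  then show ?thesis using stair_mono[of "1 - u" "1/2"] assms stair_half by (simp add: sym_stair_def)
qed

lemma sym_stair_subadditive:
  assumes "0 \<le> u" "0 \<le> v"
  shows "sym_stair (u + v) \<le> sym_stair u + sym_stair v"
proof -
  consider "u + v \<le> 1/2" | "u + v \<ge> 1" "u \<le> 1" | "u \<ge> 1"
    | "1/2 < u + v" "u + v < 1" by linarith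
  then show ?thesis
  proof cases
    case 1
    with assms have "u \<le> 1/2" "v \<le> 1/2" by auto
    with 1 show ?thesis using stair_subadditive[OF assms] by (simp add: sym_stair_def)
  next
    case 2
    then have "1 - sym_stair u \<le> sym_stair v"
      using sym_stair_reflect[of u] sym_stair_mono[of "1 - u" v] assms by simp
    then show ?thesis using sym_stair_le_1[of "u + v"] by linarith
  next
    case 3
    then show ?thesis
      using sym_stair_1[of u] sym_stair_le_1[of "u + v"] sym_stair_nonneg[of v] by linarith
  next
    case 4
    \<comment> \<open>With this third number the claim becomes symmetric: the values of
      \<open>sym_stair\<close> at three numbers with sum 1 add up to at least 1. If all are at most
      1/2, \<open>stair\<close> dominates the identity; if u or v exceeds 1/2, reflecting it reduces
      the claim to subadditivity of \<open>stair\<close> at the other two.\<close>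
    define w where "w = 1 - (u + v)"
    have w: "0 < w" "w < 1/2" "u + v + w = 1" using 4 by (auto simp: w_def)
    have red: "sym_stair (u + v) = 1 - stair w"
      using 4 by (simp add: sym_stair_def w_def)
    consider "u \<le> 1/2" "v \<le> 1/2" | "1/2 < u" | "1/2 < v" by linarith
    then show ?thesis
    proof cases
      case 1
      then show ?thesis
        using stair_ge_self[of u] stair_ge_self[of v] stair_ge_self[of w] w assms red
        by (simp add: sym_stair_def)
    next
      case 2
      moreover have "stair (1 - u) = stair (v + w)"
        by (rule arg_cong[of _ _ stair]) (use w in simp)
      ultimately have "sym_stair u = 1 - stair (v + w)" "v \<le> 1/2"
        using w assms by (auto simp: sym_stair_def)
      then show ?thesis
        using red stair_subadditive[of v w] w assms by (simp add: sym_stair_def)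
    next
      case 3
      moreover have "stair (1 - v) = stair (u + w)"
        by (rule arg_cong[of _ _ stair]) (use w in simp)
      ultimately have "sym_stair v = 1 - stair (u + w)" "u \<le> 1/2"
        using w assms by (auto simp: sym_stair_def)
      then show ?thesis
        using red stair_subadditive[of u w] w assms by (simp add: sym_stair_def)
    qed
  qed
qed

section \<open>The lift to the real line\<close>

text \<open>This is Phi of the overview. The plateau on [b, 1] comes from \<open>sym_stair\<close>
  being 1 beyond 1.\<close>

definition stair_lift :: "real \<Rightarrow> real \<Rightarrow> real" where
  "stair_lift b x = of_int \<lfloor>x\<rfloor> + sym_stair (frac x / b)"

lemma stair_lift_add_of_int: "stair_lift b (x + of_int k) = stair_lift b x + of_int k"
  by (simp add: stair_lift_def frac_def)

text \<open>Reduction modulo the integers, phrased as an induction rule so that it can be applied to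
  each variable in turn.\<close>

lemma floor_frac_induct:
  fixes P :: "real \<Rightarrow> bool"
  assumes "\<And>x. \<lbrakk>0 \<le> x; x < 1\<rbrakk> \<Longrightarrow> P x" and "\<And>x k. P x \<Longrightarrow> P (x + of_int k)"
  shows "P x"
  using assms(2)[OF assms(1)[of "frac x"], of "\<lfloor>x\<rfloor>"]
  by (simp add: frac_ge_0 frac_lt_1) (simp add: frac_def)

context
  fixes b :: real
  assumes b: "0 < b" "b \<le> 1/2"
begin

text \<open>The endpoint 1 is included: there the floor contributes 1 and \<open>frac x\<close> is
  0, which agrees with \<open>sym_stair (1 / b)\<close> since 1 \<le> 1 / b.\<close>

lemma stair_lift_unit:
  assumes "0 \<le> x" "x \<le> 1"
  shows "stair_lift b x = sym_stair (x / b)"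
proof (cases "x = 1")
  case True
  then show ?thesis using b sym_stair_1[of "1 / b"] by (simp add: stair_lift_def sym_stair_0)
next
  case False
  with assms have "frac x = x" "\<lfloor>x\<rfloor> = 0" by (auto simp: frac_eq floor_eq_iff)
  then show ?thesis by (simp add: stair_lift_def)
qed

lemma stair_lift_0: "stair_lift b 0 = 0"
  by (simp add: stair_lift_unit sym_stair_0)

lemma stair_lift_scaled: "\<lbrakk>0 \<le> u; u \<le> 1/2\<rbrakk> \<Longrightarrow> stair_lift b (b * u) = stair u"
  using b mult_mono[of b "1/2" u "1/2"] by (simp add: stair_lift_unit sym_stair_def)

lemma stair_lift_eq_1:
  assumes "b \<le> x" "x \<le> 1"
  shows "stair_lift b x = 1"
  using assms b sym_stair_1[of "x / b"] by (simp add: stair_lift_unit)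

lemma stair_lift_eq_0:
  assumes "b - 1 \<le> x" "x \<le> 0"
  shows "stair_lift b x = 0"
  using stair_lift_add_of_int[of b x 1] stair_lift_eq_1[of "x + 1"] assms by simp

lemma stair_lift_mono:
  assumes "x \<le> y"
  shows "stair_lift b x \<le> stair_lift b y"
proof (cases "\<lfloor>x\<rfloor> = \<lfloor>y\<rfloor>")
  case True
  then have "frac x / b \<le> frac y / b"
    using assms b by (intro divide_right_mono) (auto simp: frac_def)
  with True show ?thesis by (simp add: stair_lift_def sym_stair_mono)
next
  case False
  with assms have "\<lfloor>x\<rfloor> + 1 \<le> \<lfloor>y\<rfloor>" using floor_mono[OF assms] by linarith
  then have "of_int \<lfloor>x\<rfloor> + 1 \<le> (of_int \<lfloor>y\<rfloor> :: real)" by linarith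
  then show ?thesis
    using sym_stair_le_1[of "frac x / b"] sym_stair_nonneg[of "frac y / b"]
    by (simp add: stair_lift_def)
qed

lemma stair_lift_reflect: "stair_lift b (b - x) = 1 - stair_lift b x"
proof (induction x rule: floor_frac_induct)
  case (1 x)
  show ?case
  proof (cases "x \<le> b")
    case True
    then have "sym_stair (1 - x / b) = 1 - sym_stair (x / b)"
      using 1 b by (intro sym_stair_reflect) auto
    moreover have "1 - x / b = (b - x) / b" using b by (simp add: field_simps)
    ultimately show ?thesis using True 1 b by (simp add: stair_lift_unit)
  next
    case False
    then show ?thesis using 1 stair_lift_eq_0[of "b - x"] stair_lift_eq_1[of x] by simp
  qed
next
  case (2 x k)
  have "b - (x + of_int k) = (b - x) + of_int (- k)" by simp
  then show ?case using 2 by (simp only: stair_lift_add_of_int)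
qed

text \<open>For x and y in [0, 1): if one of them is at least b, its value is 1 and monotonicity
  suffices. Otherwise x + y < 2b \<le> 1, and the claim is subadditivity of
  \<open>sym_stair\<close>.\<close>

lemma stair_lift_subadditive: "stair_lift b (x + y) \<le> stair_lift b x + stair_lift b y"
proof (induction x rule: floor_frac_induct)
  case (1 x)
  then show ?case
  proof (induction y rule: floor_frac_induct)
    case (1 y)
    consider "b \<le> x" | "b \<le> y" | "x < b" "y < b" by linarith
    then show ?case
    proof cases
      case 1
      then show ?thesis
        using stair_lift_eq_1[of x] stair_lift_mono[of "x + y" "y + of_int 1"]
          stair_lift_add_of_int[of b y 1] \<open>x < 1\<close> by simp
    next
      case 2
      then show ?thesis
        using stair_lift_eq_1[of y] stair_lift_mono[of "x + y" "x + of_int 1"]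
          stair_lift_add_of_int[of b x 1] \<open>y < 1\<close> by simp
    next
      case 3
      then show ?thesis
        using 1 b sym_stair_subadditive[of "x / b" "y / b"]
        by (simp add: stair_lift_unit add_divide_distrib)
    qed
  next
    case (2 y k)
    then show ?case
      using stair_lift_add_of_int[of b "x + y" k] stair_lift_add_of_int[of b y k]
      by (simp add: add.assoc)
  qed
next
  case (2 x k)
  then show ?case
    using stair_lift_add_of_int[of b "x + y" k] stair_lift_add_of_int[of b x k]
    by (simp add: ac_simps)
qed

lemma stair_lift_ge: "x \<le> stair_lift b x"
proof (induction x rule: floor_frac_induct)
  case (1 x)
  show ?case
  proof (cases "x \<le> b")
    case True
    have "x \<le> x / b / 2" using 1 b mult_left_mono[of b "1/2" x] by (simp add: field_simps)
    also have "\<dots> \<le> stair_lift b x"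
      using 1 True b sym_stair_ge_half[of "x / b"] by (simp add: stair_lift_unit)
    finally show ?thesis .
  qed (use 1 stair_lift_eq_1[of x] in simp)
qed (simp add: stair_lift_add_of_int)

lemma continuous_on_stair_lift: "continuous_on UNIV (stair_lift b)"
proof (clarsimp simp: continuous_on_iff)
  fix x e :: real
  assume "0 < e"
  then obtain d where d: "0 < d" "d \<le> 1/2" "stair d < e" by (rule stair_small)
  \<comment> \<open>For a nondecreasing subadditive function, smallness near 0 bounds the increments
    everywhere.\<close>
  have le: "\<bar>stair_lift b x - stair_lift b y\<bar> \<le> stair_lift b \<bar>x - y\<bar>" for x y
    using stair_lift_subadditive[of "x - y" y] stair_lift_subadditive[of "y - x" x]
      stair_lift_mono[of x y] stair_lift_mono[of y x]
    by (cases "x \<le> y") auto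
  have "dist (stair_lift b y) (stair_lift b x) < e" if "dist y x < b * d" for y
    using le[of y x] stair_lift_mono[of "\<bar>y - x\<bar>" "b * d"] stair_lift_scaled[of d] d that
    by (simp add: dist_real_def)
  then show "\<exists>d>0. \<forall>y. dist y x < d \<longrightarrow> dist (stair_lift b y) (stair_lift b x) < e"
    using b d by (intro exI[of _ "b * d"]) auto
qed

text \<open>The index starts at \<open>Suc j\<close> because ramp 0 begins only at u = 1/2, where
  \<open>sym_stair\<close> stops following \<open>stair\<close>.\<close>

lemma stair_lift_ramp:
  assumes "x \<in> {b * ((1/8) ^ Suc j / 2)..b * (2 * (1/8) ^ Suc j)}"
  shows "stair_lift b x = 2 ^ Suc j / b * x"
proof -
  have x: "x / b \<in> {(1/8) ^ Suc j / 2..2 * (1/8) ^ Suc j}"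
    using assms b by (auto simp: field_simps)
  have "0 \<le> (1/8::real) ^ Suc j / 2" "2 * (1/8) ^ Suc j \<le> (1/2::real)"
    using power_le_one[of "1/8::real" j] by auto
  with x have "0 \<le> x / b" "x / b \<le> 1/2" unfolding atLeastAtMost_iff by linarith+
  with stair_ramp[OF x] stair_lift_scaled[of "x / b"] b show ?thesis by simp
qed

lemma stair_lift_derivative:
  "(stair_lift b has_real_derivative 2 ^ Suc j / b) (at (b * (1/8) ^ Suc j))"
proof (rule has_field_derivative_transform_within_open)
  let ?S = "{b * ((1/8) ^ Suc j / 2)<..<b * (2 * (1/8) ^ Suc j)}"
  show "((\<lambda>x. 2 ^ Suc j / b * x) has_real_derivative 2 ^ Suc j / b) (at (b * (1/8) ^ Suc j))"
    using b by (auto intro!: derivative_eq_intros)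
  show "open ?S" "b * (1/8) ^ Suc j \<in> ?S" using b by auto
  show "2 ^ Suc j / b * x = stair_lift b x" if "x \<in> ?S" for x
    by (rule stair_lift_ramp[symmetric]) (use that in simp)
qed

text \<open>\<open>F\<close> is a competitor after the substitution that turns the facet into
  \<open>stair_lift b\<close>; \<open>bound\<close> supplies the boundedness that the interval lemma
  requires.\<close>

lemma stair_lift_unique:
  assumes int: "\<And>x k. F (x + of_int k) = F x + of_int k"
    and reflect: "\<And>x. F (b - x) = 1 - F x"
    and F0: "F 0 = 0"
    and bound: "\<And>x. \<bar>F x - x\<bar> \<le> C"
    and add: "\<And>x y. stair_lift b (x + y) = stair_lift b x + stair_lift b y \<Longrightarrow> F (x + y) = F x + F y"
  shows "F = stair_lift b"
proof
  fix x
  have zero: "F x = 0" if "b - 1 \<le> x" "x \<le> 0" for x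
  proof -
    \<comment> \<open>Half the length of the zero interval [b - 1, 0], so that sums of two points of
      [-q, 0] stay inside it. The slope found on [-q, 0] is 0 because F (b - 1) = F b - 1 =
      0.\<close>
    define q where "q = (1 - b) / 2"
    have add0: "F (- (s + t)) = F (- s) + F (- t)" if "s \<in> {0..q}" "t \<in> {0..q}" for s t
      using add[of "- s" "- t"] that b
      by (simp add: stair_lift_eq_0 q_def algebra_simps)
    have q: "0 < q" using b by (simp add: q_def)
    obtain \<tau> where \<tau>: "\<And>t. t \<in> {0..q} \<Longrightarrow> F (- t) = F (- 0) + \<tau> * (t - 0)"
    proof (rule interval_lemma[of 0 q "\<lambda>t. F (- t)" "C + q"])
      show "\<bar>F (- t)\<bar> \<le> C + q" if "t \<in> {0..q}" for t
        using bound[of "- t"] that by auto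
    qed (use q add0 in auto)
    have "- (q + q) = b + of_int (- 1)" by (simp add: q_def field_simps)
    then have "F (- (q + q)) = 0" using int[of b "-1"] reflect[of 0] F0 by simp
    then have "\<tau> = 0" using add0[of q q] \<tau>[of q] q F0 by simp
    then show ?thesis
      using add0[of "- x / 2" "- x / 2"] \<tau>[of "- x / 2"] F0 that by (simp add: q_def)
  qed
  \<comment> \<open>Adding x - y, which lies in the zero interval, leaves the lift unchanged and
    hence is an additive relation inherited by F.\<close>
  have flat: "F x = F y" if "stair_lift b x = stair_lift b y" "x \<le> y" "y \<le> x + (1 - b)" for x y
    using add[of y "x - y"] zero[of "x - y"] stair_lift_eq_0[of "x - y"] that by simp
  \<comment> \<open>Each round appends one flat and then one ramp on the left. For n = 0 the
    interval is the single point 1/2, fixed by reflection.\<close>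
  have low: "\<forall>u\<in>{(1/8)^n / 2..1/2}. F (b * u) = stair u" for n
  proof (induction n)
    case 0
    have "F (b / 2) = 1/2" using reflect[of "b / 2"] by simp
    then show ?case by (simp add: stair_half)
  next
    case (Suc n)
    have pow: "0 < (1/8::real)^n" "(1/8::real)^n \<le> 1" by (simp_all add: power_le_one)
    have flat_case: "F (b * u) = stair u" if u: "u \<in> {(1/8)^n / 4..(1/8)^n / 2}" for u
    proof -
      let ?v = "(1/8::real)^n / 2"
      have "stair u = stair ?v" using stair_flat[OF u] stair_flat[of ?v n] pow by simp
      moreover have "b * u \<le> b * ?v" using u b by simp
      moreover have "b * ?v \<le> 1 - b" using b pow mult_mono[of b "1/2" ?v "1/2"] by simp
      moreover have "0 \<le> b * u" using u pow b by simp
      moreover have "stair_lift b (b * u) = stair u" "stair_lift b (b * ?v) = stair ?v"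
        using u pow by (intro stair_lift_scaled; simp)+
      ultimately have "F (b * u) = F (b * ?v)"
        by (intro flat) simp_all
      also have "\<dots> = stair ?v" by (rule bspec[OF Suc]) (use pow in simp)
      finally show ?thesis using \<open>stair u = stair ?v\<close> by simp
    qed
    have ramp_case: "F (b * u) = stair u" if u: "u \<in> {(1/8)^Suc n / 2..(1/8)^n / 4}" for u
    proof -
      \<comment> \<open>The left end of the ramp; its right end is 4p. For x and y in [p, 2p], the
        points x, y and x + y all lie on the ramp, so the lift is additive there.\<close>
      define p where "p = b * ((1/8)^Suc n / 2)"
      have p: "0 < p" "4 * p = b * ((1/8)^n / 4)" using b pow by (auto simp: p_def)
      have lift: "stair_lift b x = 2 ^ Suc n / b * x" if "x \<in> {p..4 * p}" for x
        by (rule stair_lift_ramp) (use that in \<open>simp add: p_def\<close>)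
      have "F (b * u) = F (4 * p) / (4 * p) * (b * u)"
      proof (rule interval_lemma_linear[of p F "C + 2 * p"])
        show "F (x + y) = F x + F y" if "x \<in> {p..2*p}" "y \<in> {p..2*p}" for x y
          using that p by (intro add) (simp add: lift algebra_simps add_divide_distrib)
        show "\<bar>F x\<bar> \<le> C + 2 * p" if "x \<in> {p..2*p}" for x
          using bound[of x] that p by auto
        show "b * u \<in> {p..4*p}" using u b p(2) by (auto simp: p_def)
      qed (use p in auto)
      \<comment> \<open>The right end of the ramp is the left end of the flat just settled.\<close>
      also have "F (4 * p) = stair_lift b (4 * p)"
        unfolding p(2) using flat_case[of "(1/8)^n / 4"] stair_lift_scaled[of "(1/8)^n / 4"] pow
        by simp
      also have "\<dots> / (4 * p) * (b * u) = 2 ^ Suc n * u"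
        using lift[of "4 * p"] p(1) b by simp
      also have "\<dots> = stair u" using u by (intro stair_ramp[symmetric]) auto
      finally show ?thesis .
    qed
    show ?case
      using Suc flat_case ramp_case by (metis atLeastAtMost_iff linear)
  qed
  have half: "F x = stair_lift b x" if "0 \<le> x" "x \<le> b / 2" for x
  proof (cases "x = 0")
    case True
    then show ?thesis by (simp add: F0 stair_lift_0)
  next
    case False
    then have u: "0 < x / b" "x / b \<le> 1/2" using that b by (auto simp: field_simps)
    then obtain n where "(1/8::real)^n < x / b"
      using real_arch_pow_inv[of "x / b" "1/8"] by auto
    moreover have "(1/8::real)^n / 2 \<le> (1/8)^n" by simp
    ultimately have "x / b \<in> {(1/8)^n / 2..1/2}"
      using u unfolding atLeastAtMost_iff by linarith
    with low[of n] have "F (b * (x / b)) = stair (x / b)" by blast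
    with stair_lift_scaled[of "x / b"] u b show ?thesis by simp
  qed
  show "F x = stair_lift b x"
  proof (induction x rule: floor_frac_induct)
    case (1 x)
    consider "x \<le> b / 2" | "b / 2 \<le> x" "x \<le> b" | "b \<le> x" by linarith
    then show ?case
    proof cases
      case 2
      then show ?thesis using half[of "b - x"] reflect[of x] stair_lift_reflect[of x] by simp
    next
      case 3
      then show ?thesis
        using zero[of "x - 1"] int[of "x - 1" 1] stair_lift_eq_1[of x] 1 by simp
    qed (use half 1 in simp)
  qed (simp add: int stair_lift_add_of_int)
qed

end

section \<open>The facet\<close>

text \<open>Either \<open>frac b\<close> or 1 - \<open>frac b\<close> is at most 1/2. The sign
  \<open>e\<close> is an integer so that multiplication by it preserves integer shifts.\<close>

lemma fractional_reflection:
  fixes b :: real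
  assumes "b \<notin> \<int>"
  obtains \<beta> :: real and e k :: int
  where "0 < \<beta>" "\<beta> \<le> 1/2" "e * e = 1" "b = of_int e * \<beta> + of_int k"
proof (cases "frac b \<le> 1/2")
  case True
  have "0 < frac b" using assms by (simp add: frac_gt_0_iff)
  with True show thesis by (intro that[of "frac b" 1 "\<lfloor>b\<rfloor>"]) (auto simp: frac_def)
next
  case False
  then show thesis
    using frac_lt_1[of b] by (intro that[of "1 - frac b" "-1" "\<lfloor>b\<rfloor> + 1"]) (auto simp: frac_def)
qed

theorem theorem1p4:
  fixes b :: real
  assumes "b \<notin> \<int>"
  shows "\<exists>\<pi> :: real \<Rightarrow> real. (\<forall>r. 0 \<le> \<pi> r) \<and> continuous_on UNIV \<pi> \<and>
           facet b \<pi> \<and> extreme_function b \<pi> \<and> infinite (slopes \<pi>)"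
proof -
  obtain \<beta> :: real and e m :: int
    where \<beta>: "0 < \<beta>" "\<beta> \<le> 1/2" and e: "e * e = 1" and b: "b = of_int e * \<beta> + of_int m"
    using assms by (rule fractional_reflection)
  define \<epsilon> :: real where "\<epsilon> = of_int e"
  have \<epsilon>: "\<epsilon> * \<epsilon> = 1" "\<epsilon> * (\<epsilon> * x) = x" for x
    using e by (simp_all add: \<epsilon>_def flip: of_int_mult mult.assoc)
  \<comment> \<open>The lift is 1 at \<open>\<beta>\<close>, so the denominator normalizes \<pi> to
    1 at b.\<close>
  define \<pi> where "\<pi> x = (stair_lift \<beta> (\<epsilon> * x) - \<epsilon> * x) / (1 - \<beta>)" for x
  have nonneg: "0 \<le> \<pi> x" for x
    using stair_lift_ge[OF \<beta>, of "\<epsilon> * x"] \<beta> by (simp add: \<pi>_def)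
  have shift: "\<epsilon> * (x + of_int k) = \<epsilon> * x + of_int (e * k)" for x k
    by (simp add: \<epsilon>_def algebra_simps)
  have period: "\<pi> (x + of_int k) = \<pi> x" for x k
    unfolding \<pi>_def shift stair_lift_add_of_int by simp
  have "b - x = \<epsilon> * (\<beta> - \<epsilon> * x) + of_int m" for x
    using \<epsilon>(2)[of x] by (simp add: b right_diff_distrib flip: \<epsilon>_def)
  \<comment> \<open>In the coordinate \<open>\<epsilon> * x\<close>, reflection about b becomes
    reflection about \<open>\<beta>\<close> modulo the integers. It is stated for every periodic
    function, to serve both \<pi> and its competitor.\<close>
  then have refl: "\<psi> (b - x) = \<psi> (\<epsilon> * (\<beta> - \<epsilon> * x))"
    if "\<And>x k. \<psi> (x + of_int k) = \<psi> x" for \<psi> :: "real \<Rightarrow> real" and x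
    by (simp add: that)
  have facet: "facet b \<pi>"
  proof (rule facet_criterion)
    show "\<pi> 0 = 0" by (simp add: \<pi>_def stair_lift_0[OF \<beta>])
    show "\<pi> (x + y) \<le> \<pi> x + \<pi> y" for x y
      using stair_lift_subadditive[OF \<beta>, of "\<epsilon> * x" "\<epsilon> * y"] \<beta>
      by (simp add: \<pi>_def distrib_left divide_right_mono flip: add_divide_distrib)
    show "\<pi> x + \<pi> (b - x) = 1" for x
      unfolding refl[of \<pi>, OF period] using stair_lift_reflect[OF \<beta>, of "\<epsilon> * x"] \<beta>
      by (simp add: \<pi>_def \<epsilon> flip: add_divide_distrib)
    show "\<psi> = \<pi>"
      if \<psi>: "\<And>x. 0 \<le> \<psi> x" "\<psi> 0 = 0" "\<And>x k. \<psi> (x + of_int k) = \<psi> x" "\<And>x. \<psi> x + \<psi> (b - x) = 1"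
        and add: "\<And>x y. \<pi> (x + y) = \<pi> x + \<pi> y \<Longrightarrow> \<psi> (x + y) = \<psi> x + \<psi> y" for \<psi>
    proof -
      \<comment> \<open>The formula for \<pi>, solved for the lift and applied to
        \<open>\<psi>\<close>.\<close>
      define F where "F x = (1 - \<beta>) * \<psi> (\<epsilon> * x) + x" for x
      have "F = stair_lift \<beta>"
      proof (rule stair_lift_unique[OF \<beta>, where C = "1 - \<beta>"])
        show "F (x + of_int k) = F x + of_int k" for x k
          unfolding F_def shift \<psi>(3) by simp
        show "F (\<beta> - x) = 1 - F x" for x
          using \<psi>(4)[of "\<epsilon> * x"] unfolding refl[of \<psi>, OF \<psi>(3)]
          by (simp add: F_def \<epsilon> eq_diff_eq[symmetric]) (simp add: algebra_simps)
        show "F 0 = 0" by (simp add: F_def \<psi>)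
        \<comment> \<open>Symmetry and nonnegativity confine \<open>\<psi>\<close> to
          [0, 1].\<close>
        show "\<bar>F x - x\<bar> \<le> 1 - \<beta>" for x
          using \<psi>(1)[of "\<epsilon> * x"] \<psi>(1)[of "b - \<epsilon> * x"] \<psi>(4)[of "\<epsilon> * x"] \<beta>
            mult_left_mono[of "\<psi> (\<epsilon> * x)" 1 "1 - \<beta>"]
          by (simp add: F_def)
        show "F (x + y) = F x + F y"
          if "stair_lift \<beta> (x + y) = stair_lift \<beta> x + stair_lift \<beta> y" for x y
        proof -
          have "\<pi> (\<epsilon> * x + \<epsilon> * y) = \<pi> (\<epsilon> * x) + \<pi> (\<epsilon> * y)"
            using that by (simp add: \<pi>_def \<epsilon> distrib_left flip: add_divide_distrib)
          then show ?thesis using add[of "\<epsilon> * x" "\<epsilon> * y"] by (simp add: F_def distrib_left)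
        qed
      qed
      then have "(1 - \<beta>) * \<psi> (\<epsilon> * (\<epsilon> * x)) + \<epsilon> * x = stair_lift \<beta> (\<epsilon> * x)" for x
        unfolding F_def by metis
      then show ?thesis using \<beta> by (simp add: fun_eq_iff \<pi>_def \<epsilon> field_simps)
    qed
  qed (fact nonneg period)+
  have cont: "continuous_on UNIV \<pi>"
    unfolding \<pi>_def using \<beta>
    by (intro continuous_intros continuous_on_compose2[OF continuous_on_stair_lift[OF \<beta>]]) auto
  \<comment> \<open>The slope of \<pi> on the image of ramp \<open>Suc j\<close>; the factor
    \<open>\<epsilon>\<close> comes from the chain rule.\<close>
  define D where "D j = (2 ^ Suc j / \<beta> - 1) / (1 - \<beta>) * \<epsilon>" for j
  have "D j \<in> slopes \<pi>" for j
  proof -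
    define z where "z = \<beta> * (1/8) ^ Suc j"
    have "((\<lambda>x. (stair_lift \<beta> x - x) / (1 - \<beta>)) has_real_derivative (2 ^ Suc j / \<beta> - 1) / (1 - \<beta>))
        (at (\<epsilon> * (\<epsilon> * z)))"
      unfolding \<epsilon>(2) z_def
      by (intro DERIV_cdivide DERIV_diff stair_lift_derivative[OF \<beta>] DERIV_ident)
    moreover have "((\<lambda>x. \<epsilon> * x) has_real_derivative \<epsilon>) (at (\<epsilon> * z))"
      by (auto intro!: derivative_eq_intros)
    ultimately have "(\<pi> has_real_derivative D j) (at (\<epsilon> * z))"
      unfolding \<pi>_def D_def by (rule DERIV_chain2)
    then show ?thesis by (auto simp: slopes_def)
  qed
  then have "range D \<subseteq> slopes \<pi>" by blast
  moreover have "inj D"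
    using \<epsilon>(1) \<beta> by (auto simp: inj_on_def D_def)
  ultimately have "infinite (slopes \<pi>)"
    using finite_subset range_inj_infinite by blast
  with nonneg cont facet facet_imp_extreme[OF facet] show ?thesis by blast
qed

end
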